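(* Let $S\equiv\pm\{3, 4, 5, 6, 7, 9, 15, 16, 17, 18, 19, 21\}\pmod{48}$ and $T\equiv\pm\{1, 3, 6, 9, 11, 13, 15, 16, 18, 20, 21, 23\}\pmod{48}$. Then $p(S,n)=p(T,n-3)$ for all $n\geq 3$.
   Context: For a set $S$ of positive integers and an integer $n\ge 0$, $p(S,n)$ denotes the number of partitions of $n$ into parts belonging to $S$ (so $p(S,0)=1$). The notation $S\equiv\pm\{r_1,\dots,r_k\}\pmod M$ means that $S$ is the set of all positive integers $n$ such that $n\equiv r_i$ or $n\equiv -r_i\pmod M$ for some $i$. *)

theory Defs
  imports "HOL-Library.Multiset" "HOL-Number_Theory.Cong"
begin

text \<open>A partition is a finite multiset of parts. The count is meaningful (the set below is
  finite) as long as 0 is not in S.\<close>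

definition num_partitions :: "nat set \<Rightarrow> nat \<Rightarrow> nat" where
  "num_partitions S n = card {P :: nat multiset. set_mset P \<subseteq> S \<and> sum_mset P = n}"

definition pm_residues :: "int set \<Rightarrow> int \<Rightarrow> nat set" where
  "pm_residues R M =
     {n. n > 0 \<and> (\<exists>r\<in>R. [int n = r] (mod M) \<or> [int n = - r] (mod M))}"

end

theory Submission
  imports Defs "HOL-Analysis.Analysis"
begin

text \<open>
  Write $(a;Q)$ for $\prod_{k\ge0}(1-aQ^k)$ and $f(a,b)$ for Ramanujan's theta series
  $\sum_j a^{j(j+1)/2}b^{j(j-1)/2}$. The claim says that the generating functions satisfy
  $G_S = 1 + q^3 G_T$. The residues of $S$ and $T$ that are not shared form the products
  $(q^5,q^7;q^{12})(q^4,q^{44};q^{48})$ and $(q,q^{11};q^{12})(q^{20},q^{28};q^{48})$, and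
  $(q^{20},q^{28};q^{48}) = (q^5,q^7;q^{12})(-q^5,-q^7;q^{12})(-q^{10},-q^{14};q^{24})$, similarly for
  $(q^4,q^{44};q^{48})$. After cancellation, the triple product turns the claim into
  \[ f(q^5,q^7)f(q^{10},q^{14}) - q^3 f(q,q^{11})f(q^2,q^{22})
     = f(-q^3,-q^6)\, f(\omega q^4,\omega^{-1} q^4), \qquad \omega^3 = 1,\ \omega \ne 1. \]
  This is multiplication by $1+\sqrt{-2}$ in the quadratic form $x^2+2y^2$: a linear change of
  the summation variables carries one double series into the other.
\<close>

section \<open>The Jacobi triple product\<close>

definition qpoch :: "complex \<Rightarrow> complex \<Rightarrow> complex" where
  "qpoch a q = (\<Prod>k. 1 - a * q ^ k)"

lemma convergent_qpoch:
  assumes "norm q < 1"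
  shows "convergent_prod (\<lambda>k. 1 - a * q ^ k :: complex)"
proof -
  have "summable (\<lambda>k. norm a * norm q ^ k)"
    using assms by (intro summable_mult summable_geometric) simp
  then show ?thesis
    by (intro abs_convergent_prod_imp_convergent_prod)
       (simp add: abs_convergent_prod_conv_summable norm_mult norm_power)
qed

lemma qpoch_LIMSEQ:
  assumes "norm q < 1"
  shows "(\<lambda>n. \<Prod>k<n. 1 - a * q ^ k) \<longlonglongrightarrow> qpoch a q"
  unfolding qpoch_def
  using convergent_prod_has_prod[OF convergent_qpoch[OF assms]] by (rule has_prod_imp_tendsto')

lemma one_minus_mult_power_nonzero:
  assumes "norm q < 1" "norm a < 1"
  shows "1 - a * q ^ k \<noteq> (0::complex)"
proof
  assume "1 - a * q ^ k = 0"
  then have "norm (a * q ^ k) = 1" by simp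
  moreover have "norm a * norm q ^ k \<le> norm a * 1"
    using assms by (intro mult_left_mono power_le_one) auto
  ultimately show False using assms by (simp add: norm_mult norm_power)
qed

lemma qpoch_nonzero:
  assumes "norm q < 1" "norm a < 1"
  shows "qpoch a q \<noteq> 0"
  unfolding qpoch_def
  using prodinf_nonzero[OF convergent_qpoch[OF assms(1)] one_minus_mult_power_nonzero[OF assms]] .

text \<open>Factors are grouped by the residue of their exponent modulo \<open>m\<close>. The
  regrouping is done on partial products of length \<open>n * m\<close>, where it is a finite
  rearrangement; uniqueness of limits then carries it over to the infinite products.\<close>

lemma qpoch_dissect:
  assumes "norm q < 1" "m > 0"
  shows "qpoch a q = (\<Prod>j<m. qpoch (a * q ^ j) (q ^ m))"
proof (rule LIMSEQ_unique)
  have q: "norm (q ^ m) < 1"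
    using assms by (simp add: norm_power power_less_one_iff)
  show "(\<lambda>n. \<Prod>k<n*m. 1 - a * q ^ k) \<longlonglongrightarrow> qpoch a q"
    using filterlim_compose[OF qpoch_LIMSEQ[OF assms(1)], of "\<lambda>n. n * m" sequentially]
      filterlim_subseq[of "\<lambda>n. n * m"] assms(2) by (simp add: strict_mono_def)
  have "(\<lambda>n. \<Prod>j<m. \<Prod>k<n. 1 - (a * q ^ j) * (q ^ m) ^ k) \<longlonglongrightarrow> (\<Prod>j<m. qpoch (a * q ^ j) (q ^ m))"
    by (intro tendsto_prod qpoch_LIMSEQ q)
  also have "(\<lambda>n. \<Prod>j<m. \<Prod>k<n. 1 - (a * q ^ j) * (q ^ m) ^ k) = (\<lambda>n. \<Prod>k<n*m. 1 - a * q ^ k)"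
  proof
    fix n
    have "(\<Prod>k<n*m. 1 - a * q ^ k) = (\<Prod>k<n. \<Prod>j\<in>{k*m..<k*m+m}. 1 - a * q ^ j)"
      by (rule prod.nat_group[symmetric])
    also have "\<dots> = (\<Prod>k<n. \<Prod>j<m. 1 - (a * q ^ j) * (q ^ m) ^ k)"
    proof (rule prod.cong)
      fix k
      show "(\<Prod>j\<in>{k*m..<k*m+m}. 1 - a * q ^ j) = (\<Prod>j<m. 1 - (a * q ^ j) * (q ^ m) ^ k)"
        by (rule prod.reindex_bij_witness[of _ "\<lambda>j. j + k * m" "\<lambda>j. j - k * m"])
           (auto simp: mult.assoc power_add[symmetric] power_mult[symmetric] mult.commute[of m])
    qed simp
    also have "\<dots> = (\<Prod>j<m. \<Prod>k<n. 1 - (a * q ^ j) * (q ^ m) ^ k)"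
      by (rule prod.swap)
    finally show "(\<Prod>j<m. \<Prod>k<n. 1 - (a * q ^ j) * (q ^ m) ^ k) = (\<Prod>k<n*m. 1 - a * q ^ k)" ..
  qed
  finally show "(\<lambda>n. \<Prod>k<n*m. 1 - a * q ^ k) \<longlonglongrightarrow> (\<Prod>j<m. qpoch (a * q ^ j) (q ^ m))" .
qed

lemma qpoch_mult_minus:
  assumes "norm q < 1"
  shows "qpoch a q * qpoch (- a) q = qpoch (a\<^sup>2) (q\<^sup>2)"
  unfolding qpoch_def
  by (subst prodinf_mult[OF convergent_qpoch[OF assms] convergent_qpoch[OF assms]], rule prodinf_cong)
     (simp add: algebra_simps power2_eq_square power_mult_distrib)

lemma cube_root_of_unity:
  fixes w :: complex
  assumes "1 + w + w\<^sup>2 = 0"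
  shows "w ^ 3 = 1"
proof -
  have "w ^ 3 - 1 = (w - 1) * (1 + w + w\<^sup>2)"
    by (simp add: algebra_simps power2_eq_square power3_eq_cube)
  then show ?thesis using assms by simp
qed

lemma qpoch_mult_cube_roots:
  assumes "norm q < 1" "1 + w + w\<^sup>2 = 0"
  shows "qpoch a q * (qpoch (w * a) q * qpoch (w\<^sup>2 * a) q) = qpoch (a ^ 3) (q ^ 3)"
proof -
  have w3: "w ^ 3 = 1" using assms(2) by (rule cube_root_of_unity)
  \<comment> \<open>Both middle coefficients of the expanded cubic are multiples of
    \<open>1 + w + w\<^sup>2\<close>, so only the constant and the cubic term survive.\<close>
  have *: "(1 - x) * ((1 - w * x) * (1 - w\<^sup>2 * x)) = 1 - x ^ 3" for x
  proof -
    have "(1 - x) * ((1 - w * x) * (1 - w\<^sup>2 * x)) =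
      1 - (1 + w + w\<^sup>2) * x + w * (1 + w + w\<^sup>2) * x\<^sup>2 - w ^ 3 * x ^ 3"
      by (simp add: algebra_simps power2_eq_square power3_eq_cube)
    then show ?thesis using assms w3 by simp
  qed
  note c = convergent_qpoch[OF assms(1)]
  show ?thesis
    unfolding qpoch_def prodinf_mult[OF c c] prodinf_mult[OF c convergent_prod_mult[OF c c]]
  proof (rule prodinf_cong)
    fix n
    show "(1 - a * q ^ n) * ((1 - w * a * q ^ n) * (1 - w\<^sup>2 * a * q ^ n)) = 1 - a ^ 3 * (q ^ 3) ^ n"
      using *[of "a * q ^ n"]
      by (simp add: mult.assoc power_mult_distrib power_mult[symmetric] mult.commute[of n])
  qed
qed

section \<open>Gaussian binomials and the finite form of the triple product\<close>

definition qfact :: "complex \<Rightarrow> nat \<Rightarrow> complex" where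
  "qfact q n = (\<Prod>k<n. 1 - q * q ^ k)"

text \<open>The lower index is an integer and the value is 0 outside the range, so that sums may run
  over all integers, index shifts are bijections, and the Pascal rules need no boundary
  conditions.\<close>

definition qbinom :: "complex \<Rightarrow> nat \<Rightarrow> int \<Rightarrow> complex" where
  "qbinom q N k = (if 0 \<le> k \<and> k \<le> int N
     then qfact q N / (qfact q (nat k) * qfact q (nat (int N - k))) else 0)"

lemma qfact_0: "qfact q 0 = 1"
  by (simp add: qfact_def)

lemma qfact_Suc: "qfact q (Suc n) = qfact q n * (1 - q ^ Suc n)"
  by (simp add: qfact_def)

lemma qfact_nonzero: "norm q < 1 \<Longrightarrow> qfact q n \<noteq> 0"
  unfolding qfact_def using one_minus_mult_power_nonzero[of q q] by auto

text \<open>The two q-Pascal rules. For \<open>k = i + 1\<close> and \<open>N = i + j + 1\<close>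
  they are the two ways of splitting \<open>1 - q ^ (i + j + 2)\<close>: as (1 - q^(i+1)) + q^(i+1)
  (1 - q^(j+1)), or as q^(j+1) (1 - q^(i+1)) + (1 - q^(j+1)). The other cases are boundary
  values.\<close>

lemma qbinom_Suc:
  assumes q: "norm q < 1" "q \<noteq> 0"
  shows qbinom_Suc_left: "qbinom q (Suc N) k = qbinom q N (k - 1) + q powi k * qbinom q N k"
    and qbinom_Suc_right: "qbinom q (Suc N) k = q powi (int N + 1 - k) * qbinom q N (k - 1) + qbinom q N k"
proof -
  consider "k < 0" | "k = 0" | "k = int N + 1" | "k > int N + 1" | "0 < k \<and> k \<le> int N" by linarith
  then have "qbinom q (Suc N) k = qbinom q N (k - 1) + q powi k * qbinom q N k \<and>
    qbinom q (Suc N) k = q powi (int N + 1 - k) * qbinom q N (k - 1) + qbinom q N k"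
  proof cases
    case 5
    define i j where "i = nat (k - 1)" and "j = nat (int N - k)"
    have k: "k = int (Suc i)" and N: "N = Suc (i + j)" using 5 by (auto simp: i_def j_def)
    have nz: "qfact q n \<noteq> 0" for n using q by (rule_tac qfact_nonzero)
    have nz': "1 - q ^ Suc n \<noteq> 0" for n
      using one_minus_mult_power_nonzero[OF q(1) q(1), of n] by simp
    have nat: "nat (int (Suc N) - k) = Suc j" "nat (int N - k) = j" "nat k = Suc i" "nat (k - 1) = i"
      "nat (int N - (k - 1)) = Suc j" using k N by auto
    have b1: "qbinom q (Suc N) k = qfact q (Suc N) / (qfact q (Suc i) * qfact q (Suc j))"
      using 5 by (simp add: qbinom_def nat del: of_nat_Suc)
    have b2: "qbinom q N k = qfact q N / (qfact q (Suc i) * qfact q j)"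
      using 5 by (simp add: qbinom_def nat del: of_nat_Suc)
    have b3: "qbinom q N (k - 1) = qfact q N / (qfact q i * qfact q (Suc j))"
      using 5 by (simp add: qbinom_def nat)
    have p1: "q powi k = q ^ Suc i" by (simp only: k power_int_of_nat)
    have p2: "q powi (int N + 1 - k) = q ^ Suc j"
    proof -
      have "int N + 1 - k = int (Suc j)" using k N by simp
      then show ?thesis by (simp only: power_int_of_nat)
    qed
    have e: "q ^ Suc N = q ^ Suc i * q ^ Suc j" by (simp add: N power_add)
    have f: "qfact q N / (qfact q i * qfact q (Suc j)) =
        qfact q N * (1 - q ^ Suc i) / (qfact q (Suc i) * qfact q (Suc j))"
      "qfact q N / (qfact q (Suc i) * qfact q j) =
        qfact q N * (1 - q ^ Suc j) / (qfact q (Suc i) * qfact q (Suc j))"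
      using nz nz' unfolding qfact_Suc by (simp_all add: divide_simps del: power_Suc)
    show ?thesis
      unfolding b1 b2 b3 p1 p2 f qfact_Suc[of q N] e
      by (simp add: add_divide_distrib[symmetric] algebra_simps del: power_Suc)
  next
    case 3
    have "qbinom q n (int n) = 1" for n
      using qfact_nonzero[OF q(1), of n] by (simp add: qbinom_def qfact_def)
    from this[of N] this[of "Suc N"] show ?thesis
      using 3 by (simp add: add.commute) (simp add: qbinom_def)
  qed (use qfact_nonzero[OF q(1)] in \<open>auto simp: qbinom_def qfact_0 nat_add_distrib\<close>)
  then show "qbinom q (Suc N) k = qbinom q N (k - 1) + q powi k * qbinom q N k"
    "qbinom q (Suc N) k = q powi (int N + 1 - k) * qbinom q N (k - 1) + qbinom q N k" by auto
qed

text \<open>The general term of Ramanujan's theta series $f(a,b)$.\<close>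

definition theta_term :: "complex \<Rightarrow> complex \<Rightarrow> int \<Rightarrow> complex" where
  "theta_term a b j = a powi (j * (j + 1) div 2) * b powi (j * (j - 1) div 2)"

text \<open>The ratio of consecutive terms is a geometric progression in \<open>j\<close>. This
  drives both the induction for the finite triple product and the ratio test.\<close>

lemma theta_term_Suc:
  assumes "a \<noteq> 0" "b \<noteq> 0"
  shows "theta_term a b (j + 1) = a * (a * b) powi j * theta_term a b j"
proof -
  have 1: "(j + 1) * (j + 1 + 1) div 2 = 1 + j + j * (j + 1) div 2"
  proof -
    have "(j + 1) * (j + 1 + 1) = j * (j + 1) + (1 + j) * 2" by (simp add: algebra_simps)
    then show ?thesis by simp
  qed
  have 2: "(j + 1) * (j + 1 - 1) div 2 = j + j * (j - 1) div 2"
  proof -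
    have "(j + 1) * (j + 1 - 1) = j * (j - 1) + j * 2" by (simp add: algebra_simps)
    then show ?thesis by simp
  qed
  show ?thesis
    unfolding theta_term_def 1 2 using assms
    by (simp add: power_int_add power_int_mult_distrib)
qed

text \<open>Each new factor of the product adds to the series a multiple of its copy with the index
  shifted by one, and a q-Pascal rule merges the two copies. One induction builds up the factors
  with \<open>b\<close>, a second one those with \<open>a\<close>.\<close>

lemma finite_jacobi_triple_product:
  assumes "a \<noteq> 0" "b \<noteq> 0" "norm (a * b) < 1"
  shows "((\<lambda>j. qbinom (a * b) (m + n) (int n + j) * theta_term a b j) has_sum
    (\<Prod>k<m. 1 + a * (a * b) ^ k) * (\<Prod>k<n. 1 + b * (a * b) ^ k)) UNIV"
proof -
  let ?q = "a * b" and ?t = "theta_term a b"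
  have q: "norm ?q < 1" "?q \<noteq> 0" using assms by auto
  \<comment> \<open>The case \<open>m = 0\<close>. The factor \<open>1 + b * ?q ^ n\<close>
    contributes the copy shifted to \<open>j + 1\<close>, which the left Pascal rule
    absorbs.\<close>
  have "((\<lambda>j. qbinom ?q n (int n + j) * ?t j) has_sum (\<Prod>k<n. 1 + b * ?q ^ k)) UNIV" for n
  proof (induction n)
    case 0
    show ?case
      by (rule has_sum_finite_neutralI[of "{0}"]) (auto simp: qbinom_def qfact_def theta_term_def)
  next
    case (Suc n)
    have "((\<lambda>j. qbinom ?q n (int n + (j + 1)) * ?t (j + 1)) has_sum (\<Prod>k<n. 1 + b * ?q ^ k)) UNIV"
      using Suc by (subst has_sum_reindex_bij_witness[of _ "\<lambda>j. j - 1" "\<lambda>j. j + 1" UNIV]) auto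
    from has_sum_add[OF Suc has_sum_cmult_right[OF this, of "b * ?q ^ n"]]
    have "((\<lambda>j. qbinom ?q n (int n + j) * ?t j + b * ?q ^ n * (qbinom ?q n (int n + (j + 1)) * ?t (j + 1)))
      has_sum (\<Prod>k<Suc n. 1 + b * ?q ^ k)) UNIV"
      by (simp add: algebra_simps)
    also have "(\<lambda>j. qbinom ?q n (int n + j) * ?t j + b * ?q ^ n * (qbinom ?q n (int n + (j + 1)) * ?t (j + 1)))
      = (\<lambda>j. qbinom ?q (Suc n) (int (Suc n) + j) * ?t j)"
    proof
      fix j
      have "b * ?q ^ n * (a * ?q powi j) = ?q powi (int (Suc n) + j)"
        using assms by (simp add: power_int_add algebra_simps)
      then have "b * ?q ^ n * (qbinom ?q n (int n + (j + 1)) * ?t (j + 1)) =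
        ?q powi (int (Suc n) + j) * qbinom ?q n (int n + (j + 1)) * ?t j"
        unfolding theta_term_Suc[OF assms(1,2)] by (simp add: mult_ac)
      moreover have "qbinom ?q (Suc n) (int (Suc n) + j) =
        qbinom ?q n (int n + j) + ?q powi (int (Suc n) + j) * qbinom ?q n (int n + (j + 1))"
        using qbinom_Suc_left[OF q, of n "int (Suc n) + j"] by (simp add: add_ac)
      ultimately show "qbinom ?q n (int n + j) * ?t j + b * ?q ^ n * (qbinom ?q n (int n + (j + 1)) * ?t (j + 1))
        = qbinom ?q (Suc n) (int (Suc n) + j) * ?t j"
        by (simp only: distrib_right)
    qed
    finally show ?case .
  qed
  note base = this
  show ?thesis
  proof (induction m)
    case 0
    show ?case using base by simp
  next
    case (Suc m)
    \<comment> \<open>The factor \<open>1 + a * ?q ^ m\<close> shifts the other way, to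
      \<open>j - 1\<close>, and calls for the right Pascal rule.\<close>
    have "((\<lambda>j. qbinom ?q (m + n) (int n + (j - 1)) * ?t (j - 1)) has_sum
        (\<Prod>k<m. 1 + a * ?q ^ k) * (\<Prod>k<n. 1 + b * ?q ^ k)) UNIV"
      using Suc by (subst has_sum_reindex_bij_witness[of _ "\<lambda>j. j + 1" "\<lambda>j. j - 1" UNIV]) auto
    from has_sum_add[OF has_sum_cmult_right[OF this, of "a * ?q ^ m"] Suc]
    have "((\<lambda>j. a * ?q ^ m * (qbinom ?q (m + n) (int n + (j - 1)) * ?t (j - 1)) +
        qbinom ?q (m + n) (int n + j) * ?t j)
      has_sum (\<Prod>k<Suc m. 1 + a * ?q ^ k) * (\<Prod>k<n. 1 + b * ?q ^ k)) UNIV"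
      by (simp add: algebra_simps)
    also have "(\<lambda>j. a * ?q ^ m * (qbinom ?q (m + n) (int n + (j - 1)) * ?t (j - 1)) +
        qbinom ?q (m + n) (int n + j) * ?t j)
      = (\<lambda>j. qbinom ?q (Suc m + n) (int n + j) * ?t j)"
    proof
      fix j
      have "a * ?q ^ m * ?t (j - 1) = ?q powi (int m + 1 - j) * (a * ?q powi (j - 1) * ?t (j - 1))"
      proof -
        have "?q powi (int m) = ?q powi ((int m + 1 - j) + (j - 1))" by simp
        also have "\<dots> = ?q powi (int m + 1 - j) * ?q powi (j - 1)"
          using q(2) by (intro power_int_add) simp
        finally show ?thesis by (simp add: mult_ac)
      qed
      also have "\<dots> = ?q powi (int m + 1 - j) * ?t j"
        using theta_term_Suc[OF assms(1,2), of "j - 1"] by simp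
      finally have 1: "a * ?q ^ m * ?t (j - 1) = ?q powi (int m + 1 - j) * ?t j" .
      have "a * ?q ^ m * (qbinom ?q (m + n) (int n + (j - 1)) * ?t (j - 1)) =
         qbinom ?q (m + n) (int n + (j - 1)) * (a * ?q ^ m * ?t (j - 1))"
        by (simp only: mult_ac)
      also have "\<dots> = ?q powi (int m + 1 - j) * qbinom ?q (m + n) (int n + (j - 1)) * ?t j"
        unfolding 1 by (simp only: mult_ac)
      finally have 2: "a * ?q ^ m * (qbinom ?q (m + n) (int n + (j - 1)) * ?t (j - 1)) =
        ?q powi (int m + 1 - j) * qbinom ?q (m + n) (int n + (j - 1)) * ?t j" .
      have "qbinom ?q (Suc m + n) (int n + j) = ?q powi (int m + 1 - j) *
         qbinom ?q (m + n) (int n + (j - 1)) + qbinom ?q (m + n) (int n + j)"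
        using qbinom_Suc_right[OF q, of "m + n" "int n + j"]
        by (simp add: algebra_simps)
      then show "a * ?q ^ m * (qbinom ?q (m + n) (int n + (j - 1)) * ?t (j - 1)) +
          qbinom ?q (m + n) (int n + j) * ?t j = qbinom ?q (Suc m + n) (int n + j) * ?t j"
        unfolding 2 by (simp only: distrib_right)
    qed
    finally show ?case .
  qed
qed

section \<open>Absolute convergence of theta series and passage to the limit\<close>

lemma summable_theta_term_nat:
  assumes "a \<noteq> 0" "b \<noteq> 0" "norm (a * b) < 1"
  shows "summable (\<lambda>n. norm (theta_term a b (int n)))"
proof -
  have "(\<lambda>n. norm a * norm (a * b) ^ n) \<longlonglongrightarrow> norm a * 0"
    using assms by (intro tendsto_mult_left LIMSEQ_power_zero) simp
  then have "eventually (\<lambda>n. norm a * norm (a * b) ^ n < 1 / 2) sequentially"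
    by (rule order_tendstoD) simp
  then obtain N where N: "\<And>n. n \<ge> N \<Longrightarrow> norm a * norm (a * b) ^ n < 1 / 2"
    by (auto simp: eventually_at_top_linorder)
  show ?thesis
  proof (rule summable_ratio_test[of "1/2" N])
    fix n assume "n \<ge> N"
    have "theta_term a b (int (Suc n)) = a * (a * b) ^ n * theta_term a b (int n)"
      using theta_term_Suc[OF assms(1,2), of "int n"] by (simp add: add.commute)
    then show "norm (norm (theta_term a b (int (Suc n)))) \<le> 1 / 2 * norm (norm (theta_term a b (int n)))"
      using mult_right_mono[OF less_imp_le[OF N[OF \<open>n \<ge> N\<close>]], of "norm (theta_term a b (int n))"]
      by (simp add: norm_mult norm_power)
  qed simp
qed

text \<open>Reflecting the index swaps the arguments, so convergence over the negative integers
  reduces to convergence over the naturals.\<close>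

lemma theta_term_uminus: "theta_term a b (- j) = theta_term b a j"
  by (simp add: theta_term_def mult.commute algebra_simps)

lemma abs_summable_theta_term:
  assumes "a \<noteq> 0" "b \<noteq> 0" "norm (a * b) < 1"
  shows "(\<lambda>j. norm (theta_term a b j)) summable_on UNIV"
proof -
  have *: "(\<lambda>j. norm (theta_term a b j)) summable_on range int"
    using summable_theta_term_nat[OF assms]
    by (subst summable_on_reindex) (auto simp: o_def intro!: norm_summable_imp_summable_on)
  have "(\<lambda>n. norm (theta_term b a (int n))) summable_on UNIV"
    using summable_theta_term_nat[of b a] assms
    by (intro norm_summable_imp_summable_on) (auto simp: mult.commute)
  then have "(\<lambda>j. norm (theta_term a b j)) summable_on range (\<lambda>n. - int n)"
    by (subst summable_on_reindex) (auto simp: o_def theta_term_uminus inj_on_def)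
  with * have "(\<lambda>j. norm (theta_term a b j)) summable_on (range int \<union> range (\<lambda>n. - int n))"
    by (rule summable_on_union)
  also have "range int \<union> range (\<lambda>n. - int n) = UNIV"
    by (auto simp: image_iff) (metis int_cases2)
  finally show ?thesis .
qed

text \<open>Dominated convergence for series over the integers: the bijection
  \<open>int_decode\<close> transports the problem to the naturals, where Tannery's theorem applies,
  and absolute summability brings the result back as an unordered sum.\<close>

lemma tannery_int:
  fixes f :: "nat \<Rightarrow> int \<Rightarrow> complex"
  assumes lim: "\<And>j. (\<lambda>n. f n j) \<longlonglongrightarrow> g j"
    and bound: "\<And>n j. norm (f n j) \<le> M j"
    and M: "M summable_on UNIV"
    and s: "\<And>n. (f n has_sum s n) UNIV" and S: "s \<longlonglongrightarrow> S"
  shows "(g has_sum S) UNIV"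
proof -
  have bij: "bij int_decode" by (rule bij_int_decode)
  have "(\<lambda>k. M (int_decode k)) summable_on UNIV"
    using M by (subst summable_on_reindex_bij_betw[OF bij])
  then have M': "summable (\<lambda>k. M (int_decode k))" by (rule summable_on_imp_summable)
  have T: "summable (\<lambda>k. norm (g (int_decode k)))"
    "(\<lambda>n. \<Sum>k. f n (int_decode k)) \<longlonglongrightarrow> (\<Sum>k. g (int_decode k))"
    using tannerys_theorem[of "\<lambda>k n. f n (int_decode k)" "\<lambda>k. g (int_decode k)" sequentially, OF lim _ M'] bound
    by (simp_all add: case_prod_unfold)
  have "((\<lambda>k. f n (int_decode k)) has_sum s n) UNIV" for n
    using s by (subst has_sum_reindex_bij_betw[OF bij])
  then have "(\<Sum>k. f n (int_decode k)) = s n" for n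
    by (intro sums_unique[symmetric] has_sum_imp_sums)
  with T(2) S have "(\<Sum>k. g (int_decode k)) = S"
    by (simp add: LIMSEQ_unique)
  then have "(\<lambda>k. g (int_decode k)) sums S"
    using summable_sums[OF summable_norm_cancel[OF T(1)]] by simp
  from norm_summable_imp_has_sum[OF T(1) this] show ?thesis
    by (subst (asm) has_sum_reindex_bij_betw[OF bij])
qed

text \<open>The finite form with \<open>m = n\<close>, as n tends to infinity. With q =
  \<open>a * b\<close>, each coefficient tends to 1/(q;q). The products \<open>qfact ?q n\<close>
  converge to a nonzero limit, so they and their inverses are bounded; this bounds all Gaussian
  binomials uniformly and supplies the majorant.\<close>

lemma jacobi_triple_product:
  assumes "a \<noteq> 0" "b \<noteq> 0" "norm (a * b) < 1"
  shows "(theta_term a b has_sum qpoch (- a) (a * b) * qpoch (- b) (a * b) * qpoch (a * b) (a * b)) UNIV"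
proof -
  let ?q = "a * b" and ?E = "qpoch (a * b) (a * b)"
  have nz: "qfact ?q n \<noteq> 0" for n using assms by (simp add: qfact_nonzero)
  have E: "qfact ?q \<longlonglongrightarrow> ?E"
    using qpoch_LIMSEQ[OF assms(3), of "a * b"] by (simp add: qfact_def[abs_def])
  have E0: "?E \<noteq> 0" using assms by (simp add: qpoch_nonzero)
  obtain K where K: "\<And>n. norm (qfact ?q n) \<le> K" "K > 0"
    using convergent_imp_Bseq[OF convergentI[OF E]] by (auto simp: Bseq_def)
  obtain L where L: "\<And>n. norm (inverse (qfact ?q n)) \<le> L" "L > 0"
    using convergent_imp_Bseq[OF convergentI[OF tendsto_inverse[OF E E0]]] by (auto simp: Bseq_def)
  have bound: "norm (qbinom ?q N k) \<le> K * (L * L)" for N k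
  proof (cases "0 \<le> k \<and> k \<le> int N")
    case True
    then have "qbinom ?q N k = qfact ?q N * (inverse (qfact ?q (nat k)) * inverse (qfact ?q (nat (int N - k))))"
      by (simp add: qbinom_def divide_simps)
    then have "norm (qbinom ?q N k) = norm (qfact ?q N) * (norm (inverse (qfact ?q (nat k))) * norm (inverse (qfact ?q (nat (int N - k)))))"
      by (simp only: norm_mult)
    also have "\<dots> \<le> K * (L * L)"
      using K L by (intro mult_mono) (auto intro: less_imp_le)
    finally show ?thesis .
  next
    case False
    then show ?thesis using K L by (auto simp: qbinom_def)
  qed
  have lim: "(\<lambda>n. qbinom ?q (n + n) (int n + j)) \<longlonglongrightarrow> ?E / (?E * ?E)" for j
  proof -
    have f1: "filterlim (\<lambda>n. n + n) at_top sequentially"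
      by (rule filterlim_subseq) (simp add: strict_mono_def)
    have f2: "filterlim (\<lambda>n. nat (int n + i)) at_top sequentially" for i
      unfolding filterlim_at_top_ge[where c = 0] eventually_at_top_linorder
    proof (intro allI impI)
      fix Z :: nat
      show "\<exists>N. \<forall>n\<ge>N. Z \<le> nat (int n + i)" by (rule exI[of _ "Z + nat (- i)"]) auto
    qed
    have "(\<lambda>n. qfact ?q (n + n) / (qfact ?q (nat (int n + j)) * qfact ?q (nat (int n + (- j))))) \<longlonglongrightarrow> ?E / (?E * ?E)"
      using E0 by (intro tendsto_intros filterlim_compose[OF E] f1 f2) auto
    \<comment> \<open>Only eventually: for n below |j| the index is out of range and
      \<open>qbinom\<close> takes its default value 0.\<close>
    moreover have "eventually (\<lambda>n. qfact ?q (n + n) / (qfact ?q (nat (int n + j)) * qfact ?q (nat (int n + (- j))))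
        = qbinom ?q (n + n) (int n + j)) sequentially"
      using eventually_ge_at_top[of "nat \<bar>j\<bar>"]
      by eventually_elim (auto simp: qbinom_def algebra_simps)
    ultimately show ?thesis by (rule Lim_transform_eventually)
  qed
  have "((\<lambda>j. ?E / (?E * ?E) * theta_term a b j) has_sum qpoch (- a) ?q * qpoch (- b) ?q) UNIV"
  proof (rule tannery_int)
    show "(\<lambda>n. qbinom ?q (n + n) (int n + j) * theta_term a b j) \<longlonglongrightarrow> ?E / (?E * ?E) * theta_term a b j" for j
      by (intro tendsto_mult_right lim)
    show "norm (qbinom ?q (n + n) (int n + j) * theta_term a b j) \<le> K * (L * L) * norm (theta_term a b j)" for n j
      unfolding norm_mult by (intro mult_right_mono bound) auto
    show "(\<lambda>j. K * (L * L) * norm (theta_term a b j)) summable_on UNIV"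
      by (intro summable_on_cmult_right abs_summable_theta_term assms)
    show "((\<lambda>j. qbinom ?q (n + n) (int n + j) * theta_term a b j) has_sum
      (\<Prod>k<n. 1 + a * ?q ^ k) * (\<Prod>k<n. 1 + b * ?q ^ k)) UNIV" for n
      by (rule finite_jacobi_triple_product[OF assms])
    show "(\<lambda>n. (\<Prod>k<n. 1 + a * ?q ^ k) * (\<Prod>k<n. 1 + b * ?q ^ k)) \<longlonglongrightarrow> qpoch (- a) ?q * qpoch (- b) ?q"
      using tendsto_mult[OF qpoch_LIMSEQ[OF assms(3), of "- a"] qpoch_LIMSEQ[OF assms(3), of "- b"]] by simp
  qed
  from has_sum_cmult_right[OF this, of ?E] E0 show ?thesis by (simp add: mult_ac)
qed

section \<open>The theta function identity\<close>

lemma infsum_int_dissect: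
  fixes f :: "int \<Rightarrow> complex" and m :: nat
  assumes "f summable_on UNIV" "m > 0"
  shows "infsum f UNIV = (\<Sum>r<m. \<Sum>\<^sub>\<infinity>l. f (int m * l + int r))"
proof -
  let ?A = "\<lambda>r. range (\<lambda>l. int m * l + int r)"
  have inj: "inj (\<lambda>l. int m * l + int r)" for r using assms(2) by (auto simp: inj_on_def)
  have U: "(\<Union>r<m. ?A r) = UNIV"
  proof (intro set_eqI iffI UNIV_I)
    fix x :: int
    have "x = int m * (x div int m) + int (nat (x mod int m))" using assms(2) by simp
    moreover have "nat (x mod int m) < m" using assms(2) by (simp add: nat_less_iff)
    ultimately show "x \<in> (\<Union>r<m. ?A r)" by blast
  qed
  have mod: "(int m * l + int r) mod int m = int r" if "r < m" for l r
    using that by simp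
  have disj: "?A r \<inter> ?A s = {}" if "r < m" "s < m" "r \<noteq> s" for r s
  proof -
    have False if "int m * l + int r = int m * l' + int s" for l l'
      using mod[OF \<open>r < m\<close>, of l] mod[OF \<open>s < m\<close>, of l'] that \<open>r \<noteq> s\<close> by simp
    then show ?thesis by auto
  qed
  have "(\<Sum>r<m. infsum f (?A r)) = infsum f (\<Union>r<m. ?A r)"
    by (rule sum_infsum) (use disj assms(1) in \<open>auto intro: summable_on_subset_banach\<close>)
  moreover have "infsum f (?A r) = (\<Sum>\<^sub>\<infinity>l. f (int m * l + int r))" for r
    by (subst infsum_reindex[OF inj]) (simp add: o_def)
  ultimately show ?thesis using U by simp
qed

text \<open>Giving the exponent through \<open>2 * e\<close> avoids the halved products, so that
  callers only have to verify a polynomial identity.\<close>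

lemma theta_term_power:
  fixes q :: complex
  assumes "q \<noteq> 0" and "2 * e = int a * (j * (j + 1)) + int b * (j * (j - 1))"
  shows "theta_term (q ^ a) (q ^ b) j = q powi e"
proof -
  have "even (j * (j + 1))" "even (j * (j - 1))" by auto
  then have "j * (j + 1) = 2 * (j * (j + 1) div 2)" "j * (j - 1) = 2 * (j * (j - 1) div 2)" by simp_all
  then have "2 * e = 2 * (int a * (j * (j + 1) div 2) + int b * (j * (j - 1) div 2))"
    using assms(2) by (metis distrib_left mult.left_commute)
  then have "e = int a * (j * (j + 1) div 2) + int b * (j * (j - 1) div 2)" by simp
  then show ?thesis
    using assms(1) by (simp add: theta_term_def power_int_add power_int_mult)
qed

lemma theta_term_mult: "theta_term (a * c) (b * d) j = theta_term a b j * theta_term c d j"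
  by (simp add: theta_term_def power_int_mult_distrib mult_ac)

text \<open>The two triangular exponents differ by exactly \<open>j\<close>. Together with
  \<open>theta_term_mult\<close> this splits off a sign or a cube root of unity as a character
  \<open>x powi j\<close>.\<close>

lemma theta_term_inverse: "x \<noteq> 0 \<Longrightarrow> theta_term x (inverse x) j = x powi j"
proof -
  assume x: "x \<noteq> 0"
  have "j * (j + 1) = j * (j - 1) + j * 2" by (simp add: algebra_simps)
  then have "j * (j + 1) div 2 = j * (j - 1) div 2 + j" by simp
  then show ?thesis
    using x by (simp add: theta_term_def power_int_add power_int_inverse)
qed

text \<open>With $d = n - m$, both double series on the left become
  $\sum_d q^{4d^2} \sum_n q^{h(3n-d)}$ with $h(w) = 2w^2 - w$, the second one with $d$ replaced by
  $d+1$ in the inner sum. The inner sum depends only on $d$ modulo 3.\<close>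

lemma theta_product_difference:
  fixes q w :: complex
  assumes q: "q \<noteq> 0" "norm q < 1" and w: "1 + w + w\<^sup>2 = 0"
  defines "\<theta> \<equiv> \<lambda>a b. infsum (theta_term a b) UNIV"
  shows "\<theta> (q ^ 5) (q ^ 7) * \<theta> (q ^ 10) (q ^ 14) - q ^ 3 * (\<theta> q (q ^ 11) * \<theta> (q ^ 2) (q ^ 22))
    = \<theta> (- (q ^ 3)) (- (q ^ 6)) * \<theta> (w * q ^ 4) (w\<^sup>2 * q ^ 4)"
proof -
  have summable: "theta_term a b summable_on UNIV" if "a \<noteq> 0" "b \<noteq> 0" "norm (a * b) < 1" for a b
    using abs_summable_theta_term[OF that] by (rule abs_summable_summable)
  have qn: "norm (q ^ n) < 1" if "n > 0" for n using q that by (simp add: norm_power power_less_one_iff)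
  have qn': "norm (q ^ a * q ^ b) < 1" if "a > 0" for a b
    using qn[of "a + b"] that by (simp add: power_add)
  have asum: "(\<lambda>j. norm (theta_term (q ^ a) (q ^ b) j)) summable_on UNIV" if "a > 0" for a b
    by (rule abs_summable_theta_term) (use q qn' that in auto)
  define h where "h = (\<lambda>v::int. 2 * v\<^sup>2 - v)"
  define g where "g = (\<lambda>d. \<Sum>\<^sub>\<infinity>n. q powi (h (3 * n - d)))"
  define \<Phi> where "\<Phi> = (\<lambda>r. \<Sum>\<^sub>\<infinity>e. q powi (4 * (3 * e + r)\<^sup>2))"
  have g_per: "g (3 * e + r) = g r" for e r
    unfolding g_def
    by (rule infsum_reindex_bij_witness[of _ "\<lambda>n. n + e" "\<lambda>n. n - e"]) (auto simp: algebra_simps)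
  \<comment> \<open>Both products on the left are instances of this scheme. The hypothesis on
    \<open>A\<close> and \<open>B\<close> is the change of variables: with the first index written
    as \<open>n - e\<close>, the quadratic form becomes diagonal in \<open>e\<close> and
    \<open>3 * n - (e + s)\<close>.\<close>
  have double: "\<theta> (q ^ a) (q ^ b) * \<theta> (q ^ c) (q ^ d) * q ^ k = (\<Sum>r<3. \<Phi> (int r) * g (int r + s))"
    if "a > 0" "c > 0" and A: "\<And>j. 2 * A j = int a * (j * (j + 1)) + int b * (j * (j - 1))"
      and B: "\<And>j. 2 * B j = int c * (j * (j + 1)) + int d * (j * (j - 1))"
      and AB: "\<And>n e. A (n - e) + B n + int k = 4 * e\<^sup>2 + h (3 * n - (e + s))"
    for a b c d k A B and s :: int
  proof -
    have tA: "theta_term (q ^ a) (q ^ b) = (\<lambda>j. q powi A j)"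
      by (intro ext theta_term_power q A)
    have tB: "theta_term (q ^ c) (q ^ d) = (\<lambda>j. q powi B j)"
      by (intro ext theta_term_power q B)
    have ab: "(\<lambda>j. norm (q powi A j)) summable_on UNIV" using asum[OF \<open>a > 0\<close>, of b] by (simp add: tA)
    have cd: "(\<lambda>j. norm (q powi B j)) summable_on UNIV" using asum[OF \<open>c > 0\<close>, of d] by (simp add: tB)
    \<comment> \<open>Summability over pairs is what permits passing between iterated and double
      sums before and after the substitution.\<close>
    have prod_sum: "(\<lambda>(m,n). q powi A m * q powi B n * q ^ k) summable_on UNIV \<times> UNIV"
    proof -
      have "(\<lambda>x. norm (case x of (m,n) \<Rightarrow> q powi A m * q powi B n * q ^ k)) summable_on UNIV \<times> UNIV"
        using ab cd
        by (subst Infinite_Sum.abs_summable_on_Sigma_iff)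
           (auto simp: norm_mult abs_mult intro!: summable_on_cmult_left summable_on_cmult_right
              summable_on_cmult_left' simp: infsum_cmult_left' infsum_cmult_right')
      then show ?thesis by (rule abs_summable_summable)
    qed
    have reindex: "(\<lambda>(e,n). q powi (4 * e\<^sup>2) * q powi (h (3 * n - (e + s)))) summable_on UNIV \<times> UNIV \<longleftrightarrow>
       (\<lambda>(m,n). q powi A m * q powi B n * q ^ k) summable_on UNIV \<times> UNIV"
      "(\<Sum>\<^sub>\<infinity>(m,n)\<in>UNIV \<times> UNIV. q powi A m * q powi B n * q ^ k)
       = (\<Sum>\<^sub>\<infinity>(e,n)\<in>UNIV \<times> UNIV. q powi (4 * e\<^sup>2) * q powi (h (3 * n - (e + s))))"
    proof -
      have *: "q powi A (n - e) * q powi B n * q ^ k = q powi (4 * e\<^sup>2) * q powi (h (3 * n - (e + s)))" for n e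
        using AB[of n e] q(1) by (metis power_int_add power_int_of_nat)
      show "(\<lambda>(e,n). q powi (4 * e\<^sup>2) * q powi (h (3 * n - (e + s)))) summable_on UNIV \<times> UNIV \<longleftrightarrow>
       (\<lambda>(m,n). q powi A m * q powi B n * q ^ k) summable_on UNIV \<times> UNIV"
        by (rule summable_on_reindex_bij_witness[of _ "\<lambda>(m,n). (n - m, n)" "\<lambda>(e,n). (n - e, n)"]) (auto simp: *)
      show "(\<Sum>\<^sub>\<infinity>(m,n)\<in>UNIV \<times> UNIV. q powi A m * q powi B n * q ^ k)
       = (\<Sum>\<^sub>\<infinity>(e,n)\<in>UNIV \<times> UNIV. q powi (4 * e\<^sup>2) * q powi (h (3 * n - (e + s))))"
        by (rule infsum_reindex_bij_witness[of _ "\<lambda>(e,n). (n - e, n)" "\<lambda>(m,n). (n - m, n)"]) (auto simp: *[symmetric])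
    qed
    have "\<theta> (q ^ a) (q ^ b) * \<theta> (q ^ c) (q ^ d) * q ^ k = (\<Sum>\<^sub>\<infinity>m. \<Sum>\<^sub>\<infinity>n. q powi A m * q powi B n * q ^ k)"
      unfolding \<theta>_def tA tB by (simp add: infsum_cmult_left' infsum_cmult_right')
    also have "\<dots> = (\<Sum>\<^sub>\<infinity>(m,n)\<in>UNIV \<times> UNIV. q powi A m * q powi B n * q ^ k)"
      by (rule infsum_Sigma'_banach[OF prod_sum])
    also note reindex(2)
    also have "(\<Sum>\<^sub>\<infinity>(e,n)\<in>UNIV \<times> UNIV. q powi (4 * e\<^sup>2) * q powi (h (3 * n - (e + s))))
       = (\<Sum>\<^sub>\<infinity>e. \<Sum>\<^sub>\<infinity>n. q powi (4 * e\<^sup>2) * q powi (h (3 * n - (e + s))))"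
      by (rule infsum_Sigma'_banach[symmetric]) (use reindex(1) prod_sum in simp)
    also have "\<dots> = (\<Sum>\<^sub>\<infinity>e. q powi (4 * e\<^sup>2) * g (e + s))"
      by (simp add: g_def infsum_cmult_right')
    \<comment> \<open>By \<open>g_per\<close> the factor \<open>g (e + s)\<close> is constant on
      residue classes of \<open>e\<close> modulo 3, so it leaves each inner sum.\<close>
    also have "\<dots> = (\<Sum>r<3. \<Sum>\<^sub>\<infinity>l. q powi (4 * (int 3 * l + int r)\<^sup>2) * g (int 3 * l + int r + s))"
    proof (rule infsum_int_dissect)
      have "(\<lambda>e. \<Sum>\<^sub>\<infinity>n. q powi (4 * e\<^sup>2) * q powi (h (3 * n - (e + s)))) summable_on UNIV"
        using summable_on_Sigma_banach[of "\<lambda>e n. q powi (4 * e\<^sup>2) * q powi (h (3 * n - (e + s)))" UNIV "\<lambda>_. UNIV"]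
          reindex(1) prod_sum by simp
      then show "(\<lambda>e. q powi (4 * e\<^sup>2) * g (e + s)) summable_on UNIV"
        by (simp add: g_def infsum_cmult_right')
    qed simp
    also have "\<dots> = (\<Sum>r<3. \<Phi> (int r) * g (int r + s))"
    proof (rule sum.cong)
      fix r :: nat
      have "g (int 3 * l + int r + s) = g (int r + s)" for l
        using g_per[of l "int r + s"] by (simp add: add.assoc)
      then show "(\<Sum>\<^sub>\<infinity>l. q powi (4 * (int 3 * l + int r)\<^sup>2) * g (int 3 * l + int r + s)) = \<Phi> (int r) * g (int r + s)"
        by (simp add: \<Phi>_def infsum_cmult_left')
    qed simp
    finally show ?thesis .
  qed
  have S1: "\<theta> (q ^ 5) (q ^ 7) * \<theta> (q ^ 10) (q ^ 14) * q ^ 0 = (\<Sum>r<3. \<Phi> (int r) * g (int r + 0))"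
    by (rule double[where A = "\<lambda>j. 6 * j\<^sup>2 - j" and B = "\<lambda>j. 12 * j\<^sup>2 - 2 * j"])
       (auto simp: h_def power2_eq_square algebra_simps)
  \<comment> \<open>The prefactor \<open>q ^ 3\<close> is exactly what completes the exponent to the
    same form, with \<open>s = 1\<close>.\<close>
  have S2: "\<theta> (q ^ 1) (q ^ 11) * \<theta> (q ^ 2) (q ^ 22) * q ^ 3 = (\<Sum>r<3. \<Phi> (int r) * g (int r + 1))"
    by (rule double[where A = "\<lambda>j. 6 * j\<^sup>2 - 5 * j" and B = "\<lambda>j. 12 * j\<^sup>2 - 10 * j"])
       (auto simp: h_def power2_eq_square algebra_simps)
  \<comment> \<open>The substitution sends \<open>3 * e + 2\<close> to the negative of
    \<open>3 * e + 1\<close>, which has the same square.\<close>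
  have \<Phi>2: "\<Phi> 2 = \<Phi> 1"
    unfolding \<Phi>_def
    by (rule infsum_reindex_bij_witness[of _ "\<lambda>e. - 1 - e" "\<lambda>e. - 1 - e"])
       (auto simp: power2_eq_square algebra_simps)
  have g3: "g 3 = g 0" using g_per[of 1 0] by simp
  \<comment> \<open>The first product gives \<open>\<Phi> 0 * g 0 + \<Phi> 1 * (g 1 + g 2)\<close>,
    the second \<open>\<Phi> 0 * g 1 + \<Phi> 1 * (g 2 + g 0)\<close>. The terms with
    \<open>g 2\<close> cancel and the difference factors.\<close>
  have L: "\<theta> (q ^ 5) (q ^ 7) * \<theta> (q ^ 10) (q ^ 14) - q ^ 3 * (\<theta> q (q ^ 11) * \<theta> (q ^ 2) (q ^ 22))
     = (\<Phi> 0 - \<Phi> 1) * (g 0 - g 1)"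
    using S1 S2 by (simp add: eval_nat_numeral \<Phi>2 g3 algebra_simps)
  \<comment> \<open>The terms of even index form \<open>g 0\<close>; those of odd index carry the
    sign and form \<open>g 1\<close> after a reflection.\<close>
  have R1: "\<theta> (- (q ^ 3)) (- (q ^ 6)) = g 0 - g 1"
  proof -
    have t: "theta_term (- (q ^ 3)) (- (q ^ 6)) j = (- 1) powi j * q powi e" if "2 * e = 9 * j\<^sup>2 - 3 * j" for j e
    proof -
      have "theta_term (- 1) (- 1) j = (- 1) powi j" using theta_term_inverse[of "- 1" j] by simp
      moreover have "theta_term (q ^ 3) (q ^ 6) j = q powi e"
        by (rule theta_term_power) (use q that in \<open>auto simp: power2_eq_square algebra_simps\<close>)
      ultimately show ?thesis using theta_term_mult[of "- 1" "q ^ 3" "- 1" "q ^ 6" j] by simp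
    qed
    have "theta_term (- (q ^ 3)) (- (q ^ 6)) summable_on UNIV"
      by (rule summable) (use q qn'[of 3 6] in auto)
    from infsum_int_dissect[OF this, of 2]
    have "\<theta> (- (q ^ 3)) (- (q ^ 6)) = (\<Sum>\<^sub>\<infinity>l. theta_term (- (q ^ 3)) (- (q ^ 6)) (2 * l)) +
        (\<Sum>\<^sub>\<infinity>l. theta_term (- (q ^ 3)) (- (q ^ 6)) (2 * l + 1))"
      by (simp add: \<theta>_def eval_nat_numeral)
    also have "(\<Sum>\<^sub>\<infinity>l. theta_term (- (q ^ 3)) (- (q ^ 6)) (2 * l)) = g 0"
      unfolding g_def
      by (rule infsum_cong, subst t[of "18 * l\<^sup>2 - 3 * l" for l]) (auto simp: h_def power2_eq_square algebra_simps)
    also have "(\<Sum>\<^sub>\<infinity>l. theta_term (- (q ^ 3)) (- (q ^ 6)) (2 * l + 1)) = (\<Sum>\<^sub>\<infinity>l. - (q powi (h (- 3 * l - 1))))"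
    proof (rule infsum_cong)
      fix l :: int
      have "theta_term (- (q ^ 3)) (- (q ^ 6)) (2 * l + 1) = (- 1) powi (2 * l + 1) * q powi (h (- 3 * l - 1))"
        by (rule t) (simp add: h_def power2_eq_square algebra_simps)
      then show "theta_term (- (q ^ 3)) (- (q ^ 6)) (2 * l + 1) = - (q powi (h (- 3 * l - 1)))"
        by (simp add: power_int_add power_int_mult)
    qed
    also have "\<dots> = - (\<Sum>\<^sub>\<infinity>l. q powi (h (- 3 * l - 1)))" by (rule infsum_uminus)
    also have "(\<Sum>\<^sub>\<infinity>l. q powi (h (- 3 * l - 1))) = g 1"
      unfolding g_def by (rule infsum_reindex_bij_witness[of _ "\<lambda>l. - l" "\<lambda>l. - l"]) auto
    finally show ?thesis by simp
  qed
  \<comment> \<open>Splitting the index modulo 3 gives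
    \<open>\<Phi> 0 + w * \<Phi> 1 + w\<^sup>2 * \<Phi> 2\<close>, where
    \<open>w + w\<^sup>2 = - 1\<close>.\<close>
  have R2: "\<theta> (w * q ^ 4) (w\<^sup>2 * q ^ 4) = \<Phi> 0 - \<Phi> 1"
  proof -
    have w3: "w ^ 3 = 1" using w by (rule cube_root_of_unity)
    then have w0: "w \<noteq> 0" by auto
    have winv: "w\<^sup>2 = inverse w"
      using w3 w0 by (simp add: field_simps power2_eq_square power3_eq_cube)
    have t: "theta_term (w * q ^ 4) (w\<^sup>2 * q ^ 4) j = w powi j * q powi (4 * j\<^sup>2)" for j
    proof -
      have "theta_term (q ^ 4) (q ^ 4) j = q powi (4 * j\<^sup>2)"
        by (rule theta_term_power) (use q in \<open>auto simp: power2_eq_square algebra_simps\<close>)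
      then show ?thesis using w0 by (simp add: theta_term_mult winv theta_term_inverse)
    qed
    have "w * q ^ 4 * (w\<^sup>2 * q ^ 4) = w ^ 3 * (q ^ 4 * q ^ 4)"
      by (simp add: power2_eq_square power3_eq_cube mult_ac)
    then have "theta_term (w * q ^ 4) (w\<^sup>2 * q ^ 4) summable_on UNIV"
      using q w0 w3 qn'[of 4 4] by (intro summable) auto
    from infsum_int_dissect[OF this, of 3]
    have "\<theta> (w * q ^ 4) (w\<^sup>2 * q ^ 4) = (\<Sum>r<3. \<Sum>\<^sub>\<infinity>l. w powi (3 * l + int r) * q powi (4 * (3 * l + int r)\<^sup>2))"
      by (simp add: \<theta>_def t)
    also have "\<dots> = (\<Sum>r<3. w ^ r * \<Phi> (int r))"
    proof (rule sum.cong)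
      fix r :: nat
      have "w powi (3 * l + int r) = w ^ r" for l
        using w0 w3 by (simp add: power_int_add power_int_mult)
      then show "(\<Sum>\<^sub>\<infinity>l. w powi (3 * l + int r) * q powi (4 * (3 * l + int r)\<^sup>2)) = w ^ r * \<Phi> (int r)"
        by (simp add: \<Phi>_def infsum_cmult_right')
    qed simp
    also have "\<dots> = \<Phi> 0 + (w + w\<^sup>2) * \<Phi> 1"
      by (simp add: eval_nat_numeral \<Phi>2 algebra_simps)
    also have "w + w\<^sup>2 = - 1" using w by (simp add: add_eq_0_iff add.assoc)
    finally show ?thesis by simp
  qed
  show ?thesis unfolding L R1 R2 by simp
qed

section \<open>Generating functions of partitions\<close>

text \<open>Removing one part, which is positive, leaves a partition of a smaller number; hence
  strong induction.\<close>

lemma finite_partitions: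
  assumes "0 \<notin> S"
  shows "finite {P :: nat multiset. set_mset P \<subseteq> S \<and> sum_mset P = n}"
proof (induction n rule: less_induct)
  case (less n)
  let ?F = "\<lambda>n. {P :: nat multiset. set_mset P \<subseteq> S \<and> sum_mset P = n}"
  have "?F n \<subseteq> {{#}} \<union> (\<Union>s\<in>{1..n}. add_mset s ` ?F (n - s))"
  proof
    fix P assume P: "P \<in> ?F n"
    show "P \<in> {{#}} \<union> (\<Union>s\<in>{1..n}. add_mset s ` ?F (n - s))"
    proof (cases P)
      case (add s Q)
      with P have "s \<in> S" "set_mset Q \<subseteq> S" "s + sum_mset Q = n" by simp_all
      moreover from this assms have "s \<noteq> 0" by metis
      ultimately have "s \<in> {1..n}" "Q \<in> ?F (n - s)" by auto
      with add show ?thesis by blast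
    qed simp
  qed
  moreover have "finite ({{#}} \<union> (\<Union>s\<in>{1..n}. add_mset s ` ?F (n - s)))"
    by (intro finite_UnI finite_UN_I finite_imageI less) auto
  ultimately show ?case by (rule finite_subset)
qed

lemma num_partitions_empty: "num_partitions {} n = (if n = 0 then 1 else 0)"
proof -
  have "{P :: nat multiset. set_mset P \<subseteq> {} \<and> sum_mset P = n} = (if n = 0 then {{#}} else {})"
    by auto
  then show ?thesis by (simp add: num_partitions_def)
qed

text \<open>Partitions are split by whether \<open>s\<close> occurs. If it does, one copy is
  removed; further copies may remain, so the set of parts stays \<open>insert s A\<close>. This is
  the coefficient form of multiplying by 1/(1 - q^s).\<close>

lemma num_partitions_insert:
  assumes "0 \<notin> A" "s > 0" "s \<notin> A"
  shows "num_partitions (insert s A) n =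
    num_partitions A n + (if s \<le> n then num_partitions (insert s A) (n - s) else 0)"
proof -
  let ?F = "\<lambda>A n. {P :: nat multiset. set_mset P \<subseteq> A \<and> sum_mset P = n}"
  let ?G = "if s \<le> n then add_mset s ` ?F (insert s A) (n - s) else {}"
  have split: "?F (insert s A) n = ?F A n \<union> ?G"
  proof (intro set_eqI iffI)
    fix P assume P: "P \<in> ?F (insert s A) n"
    show "P \<in> ?F A n \<union> ?G"
    proof (cases "s \<in># P")
      case True
      then obtain Q where "P = add_mset s Q" by (metis multi_member_split)
      with P show ?thesis by auto
    next
      case False
      with P show ?thesis by auto
    qed
  qed (auto split: if_splits)
  have "s \<in># P" if "P \<in> ?G" for P using that by (auto split: if_splits)
  moreover have "s \<notin># P" if "P \<in> ?F A n" for P using that assms(3) by blast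
  ultimately have disj: "?F A n \<inter> ?G = {}" by blast
  have "0 \<notin> insert s A" using assms by simp
  from finite_partitions[OF assms(1), of n] finite_imageI[OF finite_partitions[OF this], of "add_mset s" "n - s"]
  have fin: "finite (?F A n)" "finite ?G" by simp_all
  have "card ?G = (if s \<le> n then num_partitions (insert s A) (n - s) else 0)"
    by (simp add: num_partitions_def card_image inj_on_def)
  then show ?thesis
    unfolding num_partitions_def split card_Un_disjoint[OF fin disj] by (rule arg_cong)
qed

lemma num_partitions_restrict:
  assumes "n \<le> N"
  shows "num_partitions (S \<inter> {..N}) n = num_partitions S n"
proof -
  have "x \<le> N" if "x \<in># P" "sum_mset P = n" for x and P :: "nat multiset"
    using that assms by (auto dest!: multi_member_split)
  then have "{P :: nat multiset. set_mset P \<subseteq> S \<inter> {..N} \<and> sum_mset P = n} =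
    {P. set_mset P \<subseteq> S \<and> sum_mset P = n}" by (intro Collect_cong) blast
  then show ?thesis by (simp add: num_partitions_def)
qed

lemma num_partitions_mono:
  assumes "0 \<notin> S" "A \<subseteq> S"
  shows "num_partitions A n \<le> num_partitions S n"
  unfolding num_partitions_def using assms by (intro card_mono finite_partitions) auto

text \<open>A partial sum of \<open>a\<close> is at most \<open>suminf b\<close> plus
  \<open>c\<close> times itself, hence at most \<open>suminf b / (1 - c)\<close>. It is applied to
  partition counts weighted by powers of \<open>norm q\<close>, with
  \<open>c = norm q ^ s\<close>.\<close>

lemma summable_lag:
  fixes a b :: "nat \<Rightarrow> real"
  assumes b: "\<And>n. b n \<ge> 0" "summable b" and a: "\<And>n. a n \<ge> 0" and c: "0 \<le> c" "c < 1"
    and rec: "\<And>n. a n = b n + (if s \<le> n then c * a (n - s) else 0)"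
  shows "summable a"
proof (rule bounded_imp_summable)
  fix N
  have "(\<Sum>n\<le>N. if s \<le> n then c * a (n - s) else 0) = (\<Sum>n\<in>{n. n \<le> N \<and> s \<le> n}. c * a (n - s))"
    by (rule sum.mono_neutral_cong_right) auto
  also have "\<dots> = (\<Sum>n\<in>(\<lambda>n. n - s) ` {n. n \<le> N \<and> s \<le> n}. c * a n)"
    by (subst sum.reindex) (auto simp: inj_on_def o_def)
  also have "\<dots> \<le> (\<Sum>n\<le>N. c * a n)"
    using a c by (intro sum_mono2) auto
  finally have "(\<Sum>n\<le>N. if s \<le> n then c * a (n - s) else 0) \<le> c * (\<Sum>n\<le>N. a n)"
    by (simp add: sum_distrib_left)
  moreover have "(\<Sum>n\<le>N. a n) = (\<Sum>n\<le>N. b n) + (\<Sum>n\<le>N. if s \<le> n then c * a (n - s) else 0)"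
    by (subst rec) (simp add: sum.distrib)
  moreover have "(\<Sum>n\<le>N. b n) \<le> suminf b"
    using b by (intro sum_le_suminf) auto
  ultimately have "(1 - c) * (\<Sum>n\<le>N. a n) \<le> suminf b" by (simp add: algebra_simps)
  then show "(\<Sum>n\<le>N. a n) \<le> suminf b / (1 - c)"
    using c by (simp add: field_simps)
qed (rule a)

lemma power_neq_one:
  fixes x :: complex
  assumes "norm x < 1" "k > 0"
  shows "x ^ k \<noteq> 1"
proof -
  have "norm (x ^ k) < 1" using assms by (simp add: norm_power power_less_one_iff)
  then show ?thesis by auto
qed

lemma num_partitions_gf_finite:
  fixes q :: complex
  assumes "finite A" "0 \<notin> A" "norm q < 1"
  shows "summable (\<lambda>n. real (num_partitions A n) * norm q ^ n)"
    and "(\<lambda>n. of_nat (num_partitions A n) * q ^ n) sums (\<Prod>s\<in>A. 1 / (1 - q ^ s))"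
proof -
  have "summable (\<lambda>n. real (num_partitions A n) * norm q ^ n) \<and>
    (\<lambda>n. of_nat (num_partitions A n) * q ^ n) sums (\<Prod>s\<in>A. 1 / (1 - q ^ s))"
    using assms(1,2)
  proof (induction A)
    case empty
    have *: "(\<lambda>n. of_nat (num_partitions {} n) * x ^ n) sums 1" for x :: "'b :: real_normed_field"
    proof -
      have "(\<lambda>n. of_nat (num_partitions {} n) * x ^ n) = (\<lambda>n. if n = 0 then 1 else 0)"
        by (auto simp: num_partitions_empty)
      then show ?thesis using sums_single[of 0 "\<lambda>_. 1 :: 'b"] by simp
    qed
    from sums_summable[OF *[of "norm q"]] *[of q] show ?case by simp
  next
    case (insert s A)
    then have s: "s > 0" "0 \<notin> A" by (auto intro: gr0I)
    let ?p = "num_partitions (insert s A)"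
    note rec = num_partitions_insert[OF s(2,1) insert.hyps(2)]
    \<comment> \<open>Stated for any normed field: the real instance at \<open>norm q\<close> feeds
      \<open>summable_lag\<close>, the complex one gives the equation for the sum.\<close>
    have *: "of_nat (?p n) * x ^ n = of_nat (num_partitions A n) * x ^ n +
        (if s \<le> n then x ^ s * (of_nat (?p (n - s)) * x ^ (n - s)) else 0)"
      for x :: "'b :: real_normed_field" and n
    proof (cases "s \<le> n")
      case True
      then have 1: "x ^ n = x ^ s * x ^ (n - s)" by (simp flip: power_add)
      have "?p n = num_partitions A n + ?p (n - s)" using True by (subst rec) (rule if_P[THEN arg_cong])
      then have 2: "of_nat (?p n) = of_nat (num_partitions A n) + (of_nat (?p (n - s)) :: 'b)"
        by (simp only: of_nat_add)
      show ?thesis using True unfolding 2 by (simp only: if_True distrib_right) (simp only: 1 mult_ac)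
    next
      case False
      then have "?p n = num_partitions A n" by (subst rec) simp
      with False show ?thesis by simp
    qed
    have sum: "summable (\<lambda>n. real (?p n) * norm q ^ n)"
    proof (rule summable_lag)
      show "real (?p n) * norm q ^ n = real (num_partitions A n) * norm q ^ n +
        (if s \<le> n then norm q ^ s * (real (?p (n - s)) * norm q ^ (n - s)) else 0)" for n
        by (rule *)
    qed (use insert.IH s assms(3) in \<open>auto simp: power_less_one_iff\<close>)
    define X where "X = (\<Sum>n. of_nat (?p n) * q ^ n)"
    have X: "(\<lambda>n. of_nat (?p n) * q ^ n) sums X"
      unfolding X_def
      by (intro summable_sums summable_norm_cancel[of "\<lambda>n. of_nat (?p n) * q ^ n"])
         (use sum in \<open>simp add: norm_mult norm_power\<close>)
    have "(\<lambda>n. if s \<le> n then q ^ s * (of_nat (?p (n - s)) * q ^ (n - s)) else 0) sums (q ^ s * X)"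
    proof (subst sums_zero_iff_shift[of s, symmetric])
      show "(\<lambda>i. if s \<le> i + s then q ^ s * (of_nat (?p (i + s - s)) * q ^ (i + s - s)) else 0) sums (q ^ s * X)"
        using sums_mult[OF X, of "q ^ s"] by simp
    qed auto
    from sums_add[OF conjunct2[OF insert.IH[OF s(2)]] this]
    have "(\<lambda>n. of_nat (?p n) * q ^ n) sums ((\<Prod>s\<in>A. 1 / (1 - q ^ s)) + q ^ s * X)"
      by (simp add: *[symmetric])
    \<comment> \<open>Convergence is already known, so the recurrence becomes a linear equation for
      the sum \<open>X\<close>, solvable because \<open>q ^ s\<close> differs from 1.\<close>
    with X have "X = (\<Prod>s\<in>A. 1 / (1 - q ^ s)) + q ^ s * X"
      by (rule sums_unique2)
    moreover have "q ^ s \<noteq> 1" using assms(3) s(1) by (rule power_neq_one)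
    ultimately have "X = (\<Prod>s\<in>insert s A. 1 / (1 - q ^ s))"
      using insert.hyps by (simp add: field_simps)
    with X sum show ?case by simp
  qed
  then show "summable (\<lambda>n. real (num_partitions A n) * norm q ^ n)"
    "(\<lambda>n. of_nat (num_partitions A n) * q ^ n) sums (\<Prod>s\<in>A. 1 / (1 - q ^ s))" by auto
qed

text \<open>The set \<open>S\<close> is exhausted by the finite sets
  \<open>S \<inter> {..N}\<close>. Their products converge, their coefficients stabilise, and
  Tannery's theorem interchanges the limit with the sum, majorised by the series of \<open>S\<close>
  at \<open>norm q\<close>.\<close>

lemma num_partitions_gf:
  fixes q :: complex
  assumes "0 \<notin> S" "norm q < 1"
  shows "(\<lambda>n. of_nat (num_partitions S n) * q ^ n) sums (1 / (\<Prod>k. if k \<in> S then 1 - q ^ k else 1))"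
    and "convergent_prod (\<lambda>k. if k \<in> S then 1 - q ^ k else 1)"
proof -
  have conv: "convergent_prod (\<lambda>k. if k \<in> S then 1 - x ^ k else 1)"
    and nz: "(\<Prod>k. if k \<in> S then 1 - x ^ k else 1) \<noteq> 0"
    if x: "norm x < 1" for x :: complex
  proof -
    have "summable (\<lambda>k. norm x ^ k)" using x by (simp add: summable_geometric)
    then have "summable (\<lambda>k. norm ((if k \<in> S then 1 - x ^ k else 1) - 1))"
      by (rule summable_comparison_test'[of _ 0]) (auto simp: norm_power)
    then show *: "convergent_prod (\<lambda>k. if k \<in> S then 1 - x ^ k else 1)"
      by (intro abs_convergent_prod_imp_convergent_prod) (simp add: abs_convergent_prod_conv_summable)
    have "x ^ k \<noteq> 1" if "k \<in> S" for k
      using that assms(1) by (intro power_neq_one[OF x]) (auto intro: gr0I)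
    then have "(if k \<in> S then 1 - x ^ k else 1) \<noteq> 0" for k by auto
    with * show "(\<Prod>k. if k \<in> S then 1 - x ^ k else 1) \<noteq> 0" by (rule prodinf_nonzero)
  qed
  have lim: "(\<lambda>N. \<Prod>s\<in>S \<inter> {..N}. 1 / (1 - x ^ s)) \<longlonglongrightarrow> 1 / (\<Prod>k. if k \<in> S then 1 - x ^ k else 1)"
    if x: "norm x < 1" for x :: complex
  proof -
    have "(\<Prod>s\<in>S \<inter> {..N}. 1 / (1 - x ^ s)) = 1 / (\<Prod>k\<le>N. if k \<in> S then 1 - x ^ k else 1)" for N
      by (simp add: prod_dividef prod.If_cases Int_commute)
    then show ?thesis
      using convergent_prod_LIMSEQ[OF conv[OF x]] nz[OF x] by (auto intro!: tendsto_divide)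
  qed
  have summable: "summable (\<lambda>n. real (num_partitions S n) * norm q ^ n)"
  proof -
    \<comment> \<open>Up to degree \<open>N\<close> the counts for \<open>S\<close> and for
      \<open>S \<inter> {..N}\<close> agree, so the partial sums at \<open>norm q\<close> are
      bounded by finite products. Those are evaluated at the complex point \<open>?x\<close>, where
      they converge and hence are bounded.\<close>
    let ?x = "complex_of_real (norm q)"
    have x: "norm ?x < 1" using assms by simp
    obtain K where K: "\<And>N. norm (\<Prod>s\<in>S \<inter> {..N}. 1 / (1 - ?x ^ s)) \<le> K"
      using convergent_imp_Bseq[OF convergentI[OF lim[OF x]]] by (auto simp: Bseq_def)
    show ?thesis
    proof (rule bounded_imp_summable)
      fix N
      let ?A = "S \<inter> {..N}"
      have A: "finite ?A" "0 \<notin> ?A" using assms by auto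
      have "(\<Sum>n\<le>N. real (num_partitions S n) * norm q ^ n) = (\<Sum>n\<le>N. real (num_partitions ?A n) * norm q ^ n)"
        by (simp add: num_partitions_restrict)
      also have "\<dots> \<le> (\<Sum>n. real (num_partitions ?A n) * norm q ^ n)"
        using num_partitions_gf_finite(1)[OF A assms(2)] by (intro sum_le_suminf) auto
      also have "complex_of_real \<dots> = (\<Prod>s\<in>?A. 1 / (1 - ?x ^ s))"
      proof -
        have "(\<lambda>n. complex_of_real (real (num_partitions ?A n) * norm q ^ n)) sums
            complex_of_real (\<Sum>n. real (num_partitions ?A n) * norm q ^ n)"
          using num_partitions_gf_finite(1)[OF A assms(2)] by (intro sums_of_real summable_sums)
        then show ?thesis
          using num_partitions_gf_finite(2)[OF A x] by (simp add: sums_iff)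
      qed
      then have "(\<Sum>n. real (num_partitions ?A n) * norm q ^ n) \<le> K"
        using K[of N] by (metis abs_le_D1 norm_of_real)
      finally show "(\<Sum>n\<le>N. real (num_partitions S n) * norm q ^ n) \<le> K" .
    qed simp
  qed
  have "(\<lambda>N. \<Sum>n. of_nat (num_partitions (S \<inter> {..N}) n) * q ^ n) \<longlonglongrightarrow> (\<Sum>n. of_nat (num_partitions S n) * q ^ n)"
  proof -
    have "(\<lambda>N. of_nat (num_partitions (S \<inter> {..N}) n) * q ^ n) \<longlonglongrightarrow> of_nat (num_partitions S n) * q ^ n" for n
      by (rule tendsto_eventually, rule eventually_mono[OF eventually_ge_at_top[of n]])
         (simp add: num_partitions_restrict)
    moreover have "norm (of_nat (num_partitions (S \<inter> {..N}) n) * q ^ n) \<le> real (num_partitions S n) * norm q ^ n" for N n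
      using num_partitions_mono[OF assms(1), of "S \<inter> {..N}" n]
      by (auto simp: norm_mult norm_power intro!: mult_right_mono)
    ultimately show ?thesis
      using tannerys_theorem[of "\<lambda>n N. of_nat (num_partitions (S \<inter> {..N}) n) * q ^ n"
        "\<lambda>n. of_nat (num_partitions S n) * q ^ n" sequentially, OF _ _ summable]
      by (simp add: case_prod_unfold)
  qed
  moreover have "(\<Sum>n. of_nat (num_partitions (S \<inter> {..N}) n) * q ^ n) = (\<Prod>s\<in>S \<inter> {..N}. 1 / (1 - q ^ s))" for N
    using num_partitions_gf_finite(2)[of "S \<inter> {..N}" q] assms by (simp add: sums_iff)
  ultimately have "(\<Sum>n. of_nat (num_partitions S n) * q ^ n) = 1 / (\<Prod>k. if k \<in> S then 1 - q ^ k else 1)"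
    using lim[OF assms(2)] by (simp add: LIMSEQ_unique)
  moreover have "summable (\<lambda>n. of_nat (num_partitions S n) * q ^ n)"
    by (rule summable_norm_cancel) (use summable in \<open>simp add: norm_mult norm_power\<close>)
  ultimately show "(\<lambda>n. of_nat (num_partitions S n) * q ^ n) sums (1 / (\<Prod>k. if k \<in> S then 1 - q ^ k else 1))"
    by (simp add: sums_iff)
  show "convergent_prod (\<lambda>k. if k \<in> S then 1 - q ^ k else 1)"
    using assms(2) by (rule conv)
qed

text \<open>A block of \<open>m\<close> consecutive exponents contributes exactly one factor for
  each residue in \<open>R\<close>. Since 0 is not in \<open>R\<close>, no part is 0.\<close>

lemma num_partitions_gf_residues:
  fixes q :: complex
  assumes "finite R" "R \<subseteq> {1..<m}" "norm q < 1"
  shows "(\<lambda>n. of_nat (num_partitions {n. n mod m \<in> R} n) * q ^ n) sums (1 / (\<Prod>r\<in>R. qpoch (q ^ r) (q ^ m)))"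
proof (cases "m = 0")
  case True
  then show ?thesis using assms num_partitions_gf_finite(2)[of "{}" q] by simp
next
  case False
  let ?S = "{n. n mod m \<in> R}"
  let ?f = "\<lambda>k. if k \<in> ?S then 1 - q ^ k else 1"
  have S: "0 \<notin> ?S" using assms by auto
  have "(\<Prod>k. ?f k) = (\<Prod>r\<in>R. qpoch (q ^ r) (q ^ m))"
  proof (rule LIMSEQ_unique)
    have "(\<lambda>n. \<Prod>k<n. ?f k) \<longlonglongrightarrow> (\<Prod>k. ?f k)"
      by (rule has_prod_imp_tendsto'[OF convergent_prod_has_prod[OF num_partitions_gf(2)[OF S assms(3)]]])
    from filterlim_compose[OF this, of "\<lambda>n. n * m"]
    show "(\<lambda>n. \<Prod>k<n*m. ?f k) \<longlonglongrightarrow> (\<Prod>k. ?f k)"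
      using filterlim_subseq[of "\<lambda>n. n * m"] False by (simp add: strict_mono_def)
    have "(\<lambda>n. \<Prod>r\<in>R. \<Prod>k<n. 1 - q ^ r * (q ^ m) ^ k) \<longlonglongrightarrow> (\<Prod>r\<in>R. qpoch (q ^ r) (q ^ m))"
      using assms False by (intro tendsto_prod qpoch_LIMSEQ) (simp add: norm_power power_less_one_iff)
    also have "(\<lambda>n. \<Prod>r\<in>R. \<Prod>k<n. 1 - q ^ r * (q ^ m) ^ k) = (\<lambda>n. \<Prod>k<n*m. ?f k)"
    proof
      fix n
      have "(\<Prod>k<n*m. ?f k) = (\<Prod>k<n. \<Prod>j\<in>{k*m..<k*m+m}. ?f j)"
        by (rule prod.nat_group[symmetric])
      also have "\<dots> = (\<Prod>k<n. \<Prod>r\<in>R. 1 - q ^ r * (q ^ m) ^ k)"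
      proof (rule prod.cong)
        fix k
        have "(\<Prod>j\<in>{k*m..<k*m+m}. ?f j) = (\<Prod>j<m. if j \<in> R then 1 - q ^ j * (q ^ m) ^ k else 1)"
        proof (rule prod.reindex_bij_witness[of _ "\<lambda>j. j + k * m" "\<lambda>j. j - k * m"])
          fix j assume j: "j \<in> {k*m..<k*m+m}"
          define i where "i = j - k * m"
          have i: "j = i + k * m" "i < m" using j by (auto simp: i_def)
          have "q ^ j = q ^ i * (q ^ m) ^ k"
            unfolding i(1) power_add by (simp add: power_mult[symmetric] mult.commute)
          then show "(if j - k * m \<in> R then 1 - q ^ (j - k * m) * (q ^ m) ^ k else 1) = ?f j"
            using i by simp
        qed auto
        also have "\<dots> = (\<Prod>r\<in>R. 1 - q ^ r * (q ^ m) ^ k)"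
          using assms by (intro prod.mono_neutral_cong_right) auto
        finally show "(\<Prod>j\<in>{k*m..<k*m+m}. ?f j) = (\<Prod>r\<in>R. 1 - q ^ r * (q ^ m) ^ k)" .
      qed simp
      also have "\<dots> = (\<Prod>r\<in>R. \<Prod>k<n. 1 - q ^ r * (q ^ m) ^ k)"
        by (rule prod.swap)
      finally show "(\<Prod>r\<in>R. \<Prod>k<n. 1 - q ^ r * (q ^ m) ^ k) = (\<Prod>k<n*m. ?f k)" ..
    qed
    finally show "(\<lambda>n. \<Prod>k<n*m. ?f k) \<longlonglongrightarrow> (\<Prod>r\<in>R. qpoch (q ^ r) (q ^ m))" .
  qed
  then show ?thesis using num_partitions_gf(1)[OF S assms(3)] by simp
qed

section \<open>The product identity\<close>

lemma qpoch_power_dissect: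
  assumes "norm q < 1" "m * k = M" "M > 0"
  shows "qpoch (q ^ r) (q ^ m) = (\<Prod>j<k. qpoch (q ^ (r + m * j)) (q ^ M))"
proof -
  have "norm (q ^ m) < 1" "k > 0" using assms by (auto simp: norm_power power_less_one_iff intro!: gr0I)
  from qpoch_dissect[OF this, of "q ^ r"] show ?thesis
    using assms by (simp add: power_add power_mult[symmetric])
qed

lemma qpoch_power_mult_minus:
  assumes "norm q < 1" "m > 0"
  shows "qpoch (q ^ r) (q ^ m) * qpoch (- (q ^ r)) (q ^ m) = qpoch (q ^ (2 * r)) (q ^ (2 * m))"
proof -
  have "norm (q ^ m) < 1" using assms by (simp add: norm_power power_less_one_iff)
  from qpoch_mult_minus[OF this, of "q ^ r"] show ?thesis
    by (simp add: power_mult[symmetric] mult.commute)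
qed

lemma exists_primitive_cube_root: "\<exists>w::complex. 1 + w + w\<^sup>2 = 0"
  by (rule exI[of _ "Complex (- 1 / 2) (sqrt 3 / 2)"])
     (simp add: complex_eq_iff power2_eq_square)

text \<open>Every product in sight is written in the blocks \<open>X r\<close>, or linked to them
  through products with negated argument. The theta identity then becomes an identity between
  monomials in the \<open>X r\<close>, which are nonzero and can be cancelled.\<close>

lemma gf_product_identity:
  fixes q :: complex
  assumes "norm q < 1"
  defines "X \<equiv> \<lambda>r::nat. qpoch (q ^ r) (q ^ 48)"
  shows "1 / (\<Prod>r\<in>{3,4,5,6,7,9,15,16,17,18,19,21,27,29,30,31,32,33,39,41,42,43,44,45}. X r)
    = 1 + q ^ 3 / (\<Prod>r\<in>{1,3,6,9,11,13,15,16,18,20,21,23,25,27,28,30,32,33,35,37,39,42,45,47}. X r)"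
\<comment> \<open>Theta series contain negative powers, so q = 0 is treated apart; there all
  products equal 1.\<close>
proof (cases "q = 0")
  case True
  then show ?thesis by (simp add: X_def qpoch_def)
next
  case False
  have X0: "X r \<noteq> 0" if "r > 0" for r
    unfolding X_def using assms that by (intro qpoch_nonzero) (simp_all add: norm_power power_less_one_iff)
  have X_dissect: "qpoch (q ^ r) (q ^ m) = (\<Prod>j<k. X (r + m * j))" if "m * k = 48" for m k r
    unfolding X_def using assms(1) that by (rule qpoch_power_dissect) simp
  note expand = lessThan_nat_numeral lessThan_Suc
  have qn: "norm (q ^ n) < 1" if "n > 0" for n using assms that by (simp add: norm_power power_less_one_iff)
  have theta: "infsum (theta_term a b) UNIV = qpoch (- a) Q * qpoch (- b) Q * qpoch Q Q"
    if "a \<noteq> 0" "b \<noteq> 0" "a * b = Q" "norm Q < 1" for a b Q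
    using infsumI[OF jacobi_triple_product[of a b]] that by simp
  obtain w :: complex where w: "1 + w + w\<^sup>2 = 0" using exists_primitive_cube_root by blast
  have w3: "w ^ 3 = 1" using w by (rule cube_root_of_unity)
  then have w0: "w \<noteq> 0" by auto
  \<comment> \<open>The product form of the theta function with arguments \<open>w * q ^ 4\<close>
    and \<open>w\<^sup>2 * q ^ 4\<close>.\<close>
  define W where "W = qpoch (- (w * q ^ 4)) (q ^ 8) * qpoch (- (w\<^sup>2 * q ^ 4)) (q ^ 8) * qpoch (q ^ 8) (q ^ 8)"
  define E3 E12 E24 where "E3 = qpoch (q ^ 3) (q ^ 3)" and "E12 = qpoch (q ^ 12) (q ^ 12)"
    and "E24 = qpoch (q ^ 24) (q ^ 24)"
  define e a where "e = (\<lambda>r. qpoch (q ^ r) (q ^ 12))" and "a = (\<lambda>r. qpoch (- (q ^ r)) (q ^ 12))"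
  define c b where "c = (\<lambda>r. qpoch (q ^ r) (q ^ 24))" and "b = (\<lambda>r. qpoch (- (q ^ r)) (q ^ 24))"
  have E3: "E3 = X 3 * X 6 * X 9 * X 12 * X 15 * X 18 * X 21 * X 24 * X 27 * X 30 * X 33 * X 36 * X 39 * X 42 * X 45 * X 48"
    unfolding E3_def using X_dissect[of 3 16 3] by (simp add: expand mult_ac)
  have E12: "E12 = X 12 * X 24 * X 36 * X 48"
    unfolding E12_def using X_dissect[of 12 4 12] by (simp add: expand mult_ac)
  have E24: "E24 = X 24 * X 48"
    unfolding E24_def using X_dissect[of 24 2 24] by (simp add: expand mult_ac)
  have e_dissect: "e r = X r * X (r + 12) * X (r + 24) * X (r + 36)" for r
    unfolding e_def using X_dissect[of 12 4 r] by (simp add: expand mult_ac)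
  have ea: "e r * a r = c (2 * r)" for r
    using qpoch_power_mult_minus[OF assms(1), of 12 r] by (simp add: e_def a_def c_def)
  have cb: "c r * b r = X (2 * r)" for r
    using qpoch_power_mult_minus[OF assms(1), of 24 r] by (simp add: c_def b_def X_def)
  \<comment> \<open>Two applications of (1 - x)(1 + x) = 1 - x^2 telescope from modulus 12 through
    24 to 48.\<close>
  have eab: "e r * (a r * b (2 * r)) = X (4 * r)" for r
    using ea[of r] cb[of "2 * r"] by (simp add: mult.assoc[symmetric])
  have W: "W = X 4 * X 16 * X 20 * X 24 * X 28 * X 32 * X 44 * X 48"
  proof -
    \<comment> \<open>Multiplying by \<open>?u\<close> supplies the missing cube root of unity and
      removes \<open>w\<close>. The negated arguments in \<open>?u\<close> and \<open>b 12\<close>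
      are then removed by multiplying with \<open>?d\<close> and \<open>c 12\<close>.\<close>
    let ?u = "qpoch (- (q ^ 4)) (q ^ 8)" and ?d = "qpoch (q ^ 4) (q ^ 8)" and ?E8 = "qpoch (q ^ 8) (q ^ 8)"
    have "?u * (qpoch (w * - (q ^ 4)) (q ^ 8) * qpoch (w\<^sup>2 * - (q ^ 4)) (q ^ 8)) = b 12"
      using qpoch_mult_cube_roots[OF qn[of 8] w, of "- (q ^ 4)"] by (simp add: b_def power_mult[symmetric])
    then have 1: "?u * W = b 12 * ?E8" by (simp add: W_def mult_ac)
    have "?d * ?u = qpoch (q ^ 8) (q ^ 16)"
      using qpoch_power_mult_minus[OF assms(1), of 8 4] by simp
    also have "\<dots> = X 8 * X 24 * X 40"
      using X_dissect[of 16 3 8] by (simp add: expand mult_ac)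
    finally have 2: "?d * ?u = X 8 * X 24 * X 40" .
    have 3: "?d = X 4 * X 12 * X 20 * X 28 * X 36 * X 44"
      using X_dissect[of 8 6 4] by (simp add: expand mult_ac)
    have 4: "?E8 = X 8 * X 16 * X 24 * X 32 * X 40 * X 48"
      using X_dissect[of 8 6 8] by (simp add: expand mult_ac)
    have 5: "c 12 = X 12 * X 36"
      unfolding c_def using X_dissect[of 24 2 12] by (simp add: expand mult_ac)
    have 6: "c 12 * b 12 = X 24" using cb[of 12] by simp
    have "(?d * ?u) * c 12 * W = ?d * c 12 * (?u * W)" by (simp only: mult_ac)
    also have "\<dots> = ?d * (c 12 * b 12) * ?E8" unfolding 1 by (simp only: mult_ac)
    finally have "(X 8 * X 24 * X 40) * (X 12 * X 36) * W =
       (X 8 * X 24 * X 40) * (X 12 * X 36) * (X 4 * X 16 * X 20 * X 24 * X 28 * X 32 * X 44 * X 48)"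
      unfolding 2 6 unfolding 3 4 5 by (simp only: mult_ac)
    then show ?thesis using X0 by simp
  qed
  define P1 P2 where "P1 = a 5 * b 10 * (a 7 * b 14)" and "P2 = a 1 * b 2 * (a 11 * b 22)"
  have eab2: "e r * e s * (a r * b (2 * r) * (a s * b (2 * s))) = X (4 * r) * X (4 * s)" for r s
    unfolding eab[symmetric] by (simp only: mult_ac)
  have P1: "e 5 * e 7 * P1 = X 20 * X 28"
    using eab2[of 5 7] by (simp add: P1_def)
  have P2: "e 1 * e 11 * P2 = X 4 * X 44"
    using eab2[of 1 11] by (simp add: P2_def)
  \<comment> \<open>The theta identity with the triple product applied to all six series.\<close>
  have diff: "E12 * E24 * (P1 - q ^ 3 * P2) = E3 * W"
  proof -
    have E3': "E3 = qpoch (q ^ 3) (q ^ 9) * qpoch (q ^ 6) (q ^ 9) * qpoch (q ^ 9) (q ^ 9)"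
      unfolding E3_def using qpoch_power_dissect[OF assms(1), of 3 3 9 3] by (simp add: expand mult_ac)
    have ww: "w * q ^ 4 * (w\<^sup>2 * q ^ 4) = q ^ 8"
    proof -
      have "w * q ^ 4 * (w\<^sup>2 * q ^ 4) = w ^ 3 * q ^ (4 + 4)"
        by (simp only: power2_eq_square power3_eq_cube power_add mult_ac)
      then show ?thesis using w3 by simp
    qed
    have t: "infsum (theta_term (q ^ i) (q ^ j)) UNIV = qpoch (- (q ^ i)) (q ^ (i + j)) * qpoch (- (q ^ j)) (q ^ (i + j)) * qpoch (q ^ (i + j)) (q ^ (i + j))"
      if "i > 0" for i j
      using that qn[of "i + j"] False by (intro theta) (auto simp: power_add)
    have t': "infsum (theta_term (- (q ^ 3)) (- (q ^ 6))) UNIV = qpoch (q ^ 3) (q ^ 9) * qpoch (q ^ 6) (q ^ 9) * qpoch (q ^ 9) (q ^ 9)"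
      using theta[of "- (q ^ 3)" "- (q ^ 6)" "q ^ 9"] qn[of 9] False by (simp add: power_add[symmetric])
    have t'': "infsum (theta_term (w * q ^ 4) (w\<^sup>2 * q ^ 4)) UNIV = W"
      unfolding W_def using theta[OF _ _ ww] qn[of 8] False w0 by simp
    show ?thesis
      using theta_product_difference[OF False assms(1) w] t[of 5 7] t[of 10 14] t[of 1 11] t[of 2 22]
      unfolding t' t'' E3'[symmetric]
      by (simp add: P1_def P2_def a_def b_def E12_def[symmetric] E24_def[symmetric] algebra_simps)
  qed
  \<comment> \<open>The product over the residues common to both sides, that is plus or minus 3, 6,
    9, 15, 16, 18, 21.\<close>
  define C where "C = X 3 * X 9 * X 15 * X 21 * X 27 * X 33 * X 39 * X 45 * (X 6 * X 18 * X 30 * X 42) * (X 16 * X 32)"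
  have "(X 12 * X 24 * X 36 * X 48 * (X 24 * X 48)) * (P1 - q ^ 3 * P2) =
    (X 12 * X 24 * X 36 * X 48 * (X 24 * X 48)) * (C * (X 4 * X 44) * (X 20 * X 28))"
    using diff unfolding E3 E12 E24 W C_def by (simp only: mult_ac)
  then have D: "P1 - q ^ 3 * P2 = C * (X 4 * X 44) * (X 20 * X 28)" using X0 by simp
  define FS FT where "FS = C * (e 5 * e 7) * (X 4 * X 44)" and "FT = C * (e 1 * e 11) * (X 20 * X 28)"
  \<comment> \<open>By \<open>P1\<close> and \<open>P2\<close>, \<open>FT\<close> and
    \<open>FS\<close> equal the common product \<open>C * (e 1 * e 11) * (e 5 * e 7)\<close> times
    \<open>P1\<close> and \<open>P2\<close> respectively. By \<open>D\<close> the difference is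
    \<open>FS * FT\<close>, and dividing by it gives the claim.\<close>
  have "FT - q ^ 3 * FS = C * (e 1 * e 11) * (e 5 * e 7) * (P1 - q ^ 3 * P2)"
    unfolding FS_def FT_def P1[symmetric] P2[symmetric] by (simp add: algebra_simps)
  also have "\<dots> = FS * FT" unfolding D FS_def FT_def by (simp only: mult_ac)
  finally have "FT = FS * FT + q ^ 3 * FS" by (simp add: algebra_simps)
  moreover have "FS \<noteq> 0" "FT \<noteq> 0" using X0 by (simp_all add: FS_def FT_def C_def e_dissect)
  ultimately have main: "1 / FS = 1 + q ^ 3 / FT" by (simp add: field_simps)
  have "(\<Prod>r\<in>{3,4,5,6,7,9,15,16,17,18,19,21,27,29,30,31,32,33,39,41,42,43,44,45}. X r) = FS"
    by (simp add: FS_def C_def e_dissect mult_ac)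
  moreover have "(\<Prod>r\<in>{1,3,6,9,11,13,15,16,18,20,21,23,25,27,28,30,32,33,35,37,39,42,45,47}. X r) = FT"
    by (simp add: FT_def C_def e_dissect mult_ac)
  ultimately show ?thesis using main by simp
qed

section \<open>Comparison of coefficients and the explicit residue classes\<close>

lemma power_series_coeffs_zero:
  fixes f :: "nat \<Rightarrow> complex"
  assumes "\<And>z. norm z < 1 \<Longrightarrow> (\<lambda>n. f n * z ^ n) sums 0"
  shows "f n = 0"
proof -
  have "0 < ereal (norm (1 / 2 :: complex))" by simp
  also have "\<dots> \<le> conv_radius f"
    using assms[of "1 / 2"] by (intro conv_radius_geI) (auto simp: sums_iff)
  also have "f = fps_nth (Abs_fps f)" by (rule ext) simp
  finally have "fps_conv_radius (Abs_fps f) > 0" unfolding fps_conv_radius_def .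
  moreover have "eventually (\<lambda>z. eval_fps (Abs_fps f) z = eval_fps 0 z) (nhds 0)"
  proof -
    have "eventually (\<lambda>z::complex. z \<in> ball 0 1) (nhds 0)" by (rule eventually_nhds_in_open) auto
    then show ?thesis
      by eventually_elim (use assms in \<open>auto simp: eval_fps_def sums_iff\<close>)
  qed
  ultimately have "Abs_fps f = 0" by (intro eval_fps_eqD) auto
  then show ?thesis by (metis fps_nth_Abs_fps fps_zero_nth)
qed

lemma pm_residues_48:
  "pm_residues {3, 4, 5, 6, 7, 9, 15, 16, 17, 18, 19, 21} 48 =
    {n. n mod 48 \<in> {3,4,5,6,7,9,15,16,17,18,19,21,27,29,30,31,32,33,39,41,42,43,44,45}}"
  "pm_residues {1, 3, 6, 9, 11, 13, 15, 16, 18, 20, 21, 23} 48 =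
    {n. n mod 48 \<in> {1,3,6,9,11,13,15,16,18,20,21,23,25,27,28,30,32,33,35,37,39,42,45,47}}"
proof -
  have zmod: "int n mod 48 = int (n mod 48)" for n by (simp only: zmod_int of_nat_numeral)
  have num: "int n mod 48 = numeral k \<longleftrightarrow> n mod 48 = numeral k" for n k
    unfolding zmod by (rule of_nat_eq_numeral_iff)
  have one: "int n mod 48 = 1 \<longleftrightarrow> n mod 48 = 1" for n
    unfolding zmod by (rule of_nat_eq_1_iff)
  have eq: "pm_residues R 48 = {n. n mod 48 \<in> Q}"
    if "0 \<notin> Q" "\<And>n. (\<exists>r\<in>R. int n mod 48 = r mod 48 \<or> int n mod 48 = (- r) mod 48) \<longleftrightarrow> n mod 48 \<in> Q" for R Q
  proof -
    have "n > 0" if "n mod 48 \<in> Q" for n using that \<open>0 \<notin> Q\<close> by (cases n) auto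
    then show ?thesis unfolding pm_residues_def unique_euclidean_semiring_class.cong_def that(2) by blast
  qed
  show "pm_residues {3, 4, 5, 6, 7, 9, 15, 16, 17, 18, 19, 21} 48 =
    {n. n mod 48 \<in> {3,4,5,6,7,9,15,16,17,18,19,21,27,29,30,31,32,33,39,41,42,43,44,45}}"
    by (rule eq) (simp, simp add: num one del: of_nat_mod, blast)
  show "pm_residues {1, 3, 6, 9, 11, 13, 15, 16, 18, 20, 21, 23} 48 =
    {n. n mod 48 \<in> {1,3,6,9,11,13,15,16,18,20,21,23,25,27,28,30,32,33,35,37,39,42,45,47}}"
    by (rule eq) (simp, simp add: num one del: of_nat_mod One_nat_def, blast)
qed

theorem theorem7p4:
  fixes S T :: "nat set" and n :: nat
  assumes "S = pm_residues {3, 4, 5, 6, 7, 9, 15, 16, 17, 18, 19, 21} 48"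
    and "T = pm_residues {1, 3, 6, 9, 11, 13, 15, 16, 18, 20, 21, 23} 48"
    and "n \<ge> 3"
  shows "num_partitions S n = num_partitions T (n - 3)"
proof -
  \<comment> \<open>The coefficients of G_S - 1 - q^3 G_T. The guard \<open>3 \<le> n\<close> keeps
    truncated subtraction from producing terms of low degree.\<close>
  let ?c = "\<lambda>n. of_nat (num_partitions S n) - ((if n = 0 then 1 else 0) +
    (if 3 \<le> n then of_nat (num_partitions T (n - 3)) else 0)) :: complex"
  have "(\<lambda>n. ?c n * q ^ n) sums 0" if q: "norm q < 1" for q
  proof -
    define FS where "FS = (\<Prod>r\<in>{3,4,5,6,7,9,15,16,17,18,19,21,27,29,30,31,32,33,39,41,42,43,44,45}. qpoch (q ^ r) (q ^ 48))"
    define FT where "FT = (\<Prod>r\<in>{1,3,6,9,11,13,15,16,18,20,21,23,25,27,28,30,32,33,35,37,39,42,45,47}. qpoch (q ^ r) (q ^ 48))"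
    have S: "(\<lambda>n. of_nat (num_partitions S n) * q ^ n) sums (1 / FS)"
      unfolding assms(1) pm_residues_48 FS_def using q by (intro num_partitions_gf_residues) auto
    have T: "(\<lambda>n. of_nat (num_partitions T n) * q ^ n) sums (1 / FT)"
      unfolding assms(2) pm_residues_48 FT_def using q by (intro num_partitions_gf_residues) auto
    have T': "(\<lambda>n. if 3 \<le> n then of_nat (num_partitions T (n - 3)) * q ^ n else 0) sums (q ^ 3 / FT)"
    proof (subst sums_zero_iff_shift[of 3, symmetric])
      show "(\<lambda>i. if 3 \<le> i + 3 then of_nat (num_partitions T (i + 3 - 3)) * q ^ (i + 3) else 0) sums (q ^ 3 / FT)"
        using sums_mult[OF T, of "q ^ 3"] by (simp add: power_add mult_ac)
    qed auto
    have "(\<lambda>n. of_nat (num_partitions S n) * q ^ n - ((if n = 0 then 1 else 0) +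
       (if 3 \<le> n then of_nat (num_partitions T (n - 3)) * q ^ n else 0))) sums (1 / FS - (1 + q ^ 3 / FT))"
      by (intro sums_diff sums_add S T' sums_single[of 0 "\<lambda>_. 1"])
    moreover have "1 / FS = 1 + q ^ 3 / FT"
      unfolding FS_def FT_def by (rule gf_product_identity[OF q])
    moreover have "of_nat (num_partitions S n) * q ^ n - ((if n = 0 then 1 else 0) +
       (if 3 \<le> n then of_nat (num_partitions T (n - 3)) * q ^ n else 0)) = ?c n * q ^ n" for n
      by (simp add: algebra_simps)
    ultimately show ?thesis by simp
  qed
  from power_series_coeffs_zero[of ?c, OF this, of n]
  have "of_nat (num_partitions S n) = (of_nat (num_partitions T (n - 3)) :: complex)"
    using assms(3) by simp
  then show ?thesis by (simp only: of_nat_eq_iff)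
qed

end
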